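(* Let $\Phi=(D,\varphi)$ be a $\mathbb{T}$-gain digraph whose underlying digraph $D$ is strongly connected. Then the following are equivalent: (i) $\Phi$ is cycle balanced. (ii) $\Phi\sim(D,\mathbf{1})$, i.e., $\Phi$ has a potential function. (iii) $L(\Phi)$ is cospectral with $L(D)$. (iv) $0$ is an eigenvalue of $L(\Phi)$.
   Context: A digraph $D=(V,\mathcal{A})$ has a finite vertex set $V=\{v_1,\dots,v_n\}$ and a set $\mathcal{A}$ of ordered pairs of distinct vertices, called arcs (no loops; at most one arc from $v_i$ to $v_j$ for each ordered pair; opposite arcs may both be present). The out-degree $\deg^+(v)$ is the number of arcs leaving $v$. A directed cycle is a closed directed walk whose vertices are distinct except that the first and last coincide (so its length is at least $2$; length $2$ is allowed). $D$ is strongly connected if every ordered pair of vertices is joined by a directed path. Let $\mathbb{T}=\{z\in\mathbb{C}:|z|=1\}$. A $\mathbb{T}$-gain digraph is a pair $\Phi=(D,\varphi)$ with $\varphi:\mathcal{A}\to\mathbb{T}$ an arbitrary function (no relation between gains of opposite arcs). Its gain adjacency matrix $A(\Phi)$ has entries $A(\Phi)_{ij}=\varphi(v_i,v_j)$ if $(v_i,v_j)\in\mathcal{A}$ and $0$ otherwise; $A(D)$ is the $0/1$ adjacency matrix of $D$ (all gains $1$). With $D^+=\operatorname{diag}(\deg^+(v_1),\dots,\deg^+(v_n))$, the Laplacian matrices are $L(\Phi)=D^+-A(\Phi)$ and $L(D)=D^+-A(D)$. The gain $\varphi(C)$ of a directed cycle is the product of the gains of its arcs; $\Phi$ is cycle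 balanced if $\varphi(C)=1$ for every directed cycle $C$ of $D$. For $\sigma:V\to\mathbb{T}$, $\Phi^\sigma=(D,\varphi^\sigma)$ with $\varphi^\sigma(v_i,v_j)=\sigma(v_i)\varphi(v_i,v_j)\overline{\sigma(v_j)}$; $\Phi\sim\Phi'$ (switching equivalent) means $\Phi'=\Phi^\sigma$ for some $\sigma$. $(D,\mathbf{1})$ denotes $D$ with every arc given gain $1$. A potential function for $\varphi$ is a map $\psi:V\to\mathbb{T}$ with $\varphi(v_i,v_j)=\overline{\psi(v_i)}\,\psi(v_j)$ for every arc $(v_i,v_j)$; its existence means exactly $\Phi\sim(D,\mathbf{1})$. Two matrices are cospectral if they have the same characteristic polynomial. *)

theory Defs
  imports
    Complex_Main
    "Graph_Theory.Digraph_Component"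
    "Jordan_Normal_Form.Char_Poly"
begin

definition unit_circle :: "complex set" where
  "unit_circle = {z. cmod z = 1}"

text \<open>
  The gain is a total function on pairs; only its values on arcs are meaningful,
  and every definition below looks at it on arcs only.
\<close>

locale gain_digraph = pair_digraph D
  for D :: "'a pair_pre_digraph" +
  fixes \<phi> :: "'a \<times> 'a \<Rightarrow> complex"
  assumes gain_unit: "e \<in> parcs D \<Longrightarrow> \<phi> e \<in> unit_circle"

text \<open>
  Matrices are indexed from 0 through a list \<open>vs\<close> that enumerates the vertices:
  row and column \<open>i\<close> belong to the vertex \<open>vs ! i\<close>.
\<close>

definition gain_adj_mat ::
  "'a pair_pre_digraph \<Rightarrow> ('a \<times> 'a \<Rightarrow> complex) \<Rightarrow> 'a list \<Rightarrow> complex mat" where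
  "gain_adj_mat D \<phi> vs = mat (length vs) (length vs)
     (\<lambda>(i, j). if (vs ! i, vs ! j) \<in> parcs D then \<phi> (vs ! i, vs ! j) else 0)"

definition adj_mat :: "'a pair_pre_digraph \<Rightarrow> 'a list \<Rightarrow> complex mat" where
  "adj_mat D vs = mat (length vs) (length vs)
     (\<lambda>(i, j). if (vs ! i, vs ! j) \<in> parcs D then 1 else 0)"

definition out_deg_mat :: "'a pair_pre_digraph \<Rightarrow> 'a list \<Rightarrow> complex mat" where
  "out_deg_mat D vs = mat_diag (length vs) (\<lambda>i. of_nat (out_degree (with_proj D) (vs ! i)))"

definition gain_laplacian ::
  "'a pair_pre_digraph \<Rightarrow> ('a \<times> 'a \<Rightarrow> complex) \<Rightarrow> 'a list \<Rightarrow> complex mat" where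
  "gain_laplacian D \<phi> vs = out_deg_mat D vs - gain_adj_mat D \<phi> vs"

definition laplacian :: "'a pair_pre_digraph \<Rightarrow> 'a list \<Rightarrow> complex mat" where
  "laplacian D vs = out_deg_mat D vs - adj_mat D vs"

definition cospectral :: "complex mat \<Rightarrow> complex mat \<Rightarrow> bool" where
  "cospectral A B \<longleftrightarrow> char_poly A = char_poly B"

definition walk_gain :: "('a \<times> 'a \<Rightarrow> complex) \<Rightarrow> ('a \<times> 'a) list \<Rightarrow> complex" where
  "walk_gain \<phi> p = prod_list (map \<phi> p)"

text \<open>
  A cycle is a nonempty closed arc list without repeated vertices apart from the common
  first and last one. Length 2 is allowed; length 1 cannot occur in a loop-free digraph.
\<close>

definition cycle_balanced :: "'a pair_pre_digraph \<Rightarrow> ('a \<times> 'a \<Rightarrow> complex) \<Rightarrow> bool" where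
  "cycle_balanced D \<phi> \<longleftrightarrow> (\<forall>p. pre_digraph.cycle (with_proj D) p \<longrightarrow> walk_gain \<phi> p = 1)"

definition switch_gain ::
  "('a \<Rightarrow> complex) \<Rightarrow> ('a \<times> 'a \<Rightarrow> complex) \<Rightarrow> 'a \<times> 'a \<Rightarrow> complex" where
  "switch_gain \<sigma> \<phi> = (\<lambda>(u, v). \<sigma> u * \<phi> (u, v) * cnj (\<sigma> v))"

text \<open>Equality of gain functions on the same digraph means agreement on its arcs.\<close>

definition switching_equivalent ::
  "'a pair_pre_digraph \<Rightarrow> ('a \<times> 'a \<Rightarrow> complex) \<Rightarrow> ('a \<times> 'a \<Rightarrow> complex) \<Rightarrow> bool" where
  "switching_equivalent D \<phi> \<phi>' \<longleftrightarrow>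
     (\<exists>\<sigma>. \<sigma> ` pverts D \<subseteq> unit_circle \<and> (\<forall>e \<in> parcs D. \<phi>' e = switch_gain \<sigma> \<phi> e))"

definition potential_function ::
  "'a pair_pre_digraph \<Rightarrow> ('a \<times> 'a \<Rightarrow> complex) \<Rightarrow> ('a \<Rightarrow> complex) \<Rightarrow> bool" where
  "potential_function D \<phi> \<psi> \<longleftrightarrow>
     \<psi> ` pverts D \<subseteq> unit_circle \<and> (\<forall>(u, v) \<in> parcs D. \<phi> (u, v) = cnj (\<psi> u) * \<psi> v)"

end

theory Submission
  imports Defs "HOL-Analysis.Inner_Product"
begin

text \<open>
  For a strongly connected digraph, cycle balance means that the gain of a walk depends only on
  its end points, so the gains of walks from a fixed root form a potential function. A potential
  function conjugates \<open>L(\<Phi>)\<close> into \<open>L(D)\<close> by a diagonal matrix, and \<open>L(D)\<close> kills the all-ones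
  vector. Conversely, let \<open>L(\<Phi>) x = 0\<close> with \<open>x \<noteq> 0\<close>. At a vertex \<open>v\<close> where \<open>|x|\<close> is maximal,
  \<open>x\<^sub>v\<close> is the average of the numbers \<open>\<phi>(v, w) x\<^sub>w\<close>, which have modulus at most \<open>|x\<^sub>v|\<close>; hence all of
  them equal \<open>x\<^sub>v\<close>, and \<open>|x|\<close> is again maximal at the out-neighbours of \<open>v\<close>. By strong
  connectedness this happens everywhere, and the conjugate of \<open>x\<close>, normalised, is a potential
  function.
\<close>

text \<open>This is the equality case of Cauchy-Schwarz. Paired with \<open>a\<close>, every
  difference \<open>a - b t\<close> is nonnegative, and these numbers sum to 0, so each vanishes.
  The complex plane is later used as a real inner product space.\<close>

lemma eq_center_if_sum_diff_eq_0:
  fixes a :: "'b::real_inner"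
  assumes "finite S" "(\<Sum>s\<in>S. a - b s) = 0" "\<And>s. s \<in> S \<Longrightarrow> norm (b s) \<le> norm a" "s \<in> S"
  shows "b s = a"
proof -
  have nonneg: "inner a (a - b t) \<ge> 0" if "t \<in> S" for t
  proof -
    have "inner a (b t) \<le> norm a * norm (b t)" by (rule norm_cauchy_schwarz)
    also have "\<dots> \<le> norm a * norm a" using assms(3)[OF that] by (simp add: mult_left_mono)
    finally show ?thesis by (simp add: inner_diff_right dot_square_norm power2_eq_square)
  qed
  have "(\<Sum>t\<in>S. inner a (a - b t)) = 0"
    using assms(2) by (metis inner_sum_right inner_zero_right)
  then have "inner a (a - b s) = 0"
    using sum_nonneg_eq_0_iff[OF assms(1), of "\<lambda>t. inner a (a - b t)"] nonneg assms(4) by auto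
  then have "(norm (a - b s))\<^sup>2 = (norm (b s))\<^sup>2 - (norm a)\<^sup>2"
    by (simp add: power2_norm_eq_inner inner_diff inner_commute)
  also have "\<dots> \<le> 0" using assms(3)[OF assms(4)] by (simp add: power_mono)
  finally show ?thesis by simp
qed

lemma unit_circle_iff_cnj: "z \<in> unit_circle \<longleftrightarrow> z * cnj z = 1"
proof -
  have "z * cnj z = 1 \<longleftrightarrow> (cmod z)\<^sup>2 = 1"
    unfolding complex_norm_square[symmetric] of_real_eq_1_iff ..
  also have "\<dots> \<longleftrightarrow> cmod z = 1" by (rule abs_square_eq_1[of "cmod z", unfolded abs_norm_cancel])
  finally show ?thesis by (simp add: unit_circle_def)
qed

section \<open>Walk gains, cycle balance and potentials\<close>

lemma walk_gain_append: "walk_gain \<phi> (p @ q) = walk_gain \<phi> p * walk_gain \<phi> q"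
  by (simp add: walk_gain_def)

lemma walk_gain_Cons: "walk_gain \<phi> (e # p) = \<phi> e * walk_gain \<phi> p"
  by (simp add: walk_gain_def)

lemma walk_gain_Nil: "walk_gain \<phi> [] = 1"
  by (simp add: walk_gain_def)

text \<open>Induction on length. A closed walk that is not a cycle repeats a vertex \<open>w\<close>
  after its first arc. Cutting there splits off a nonempty closed walk \<open>r\<close>; both
  \<open>r\<close> and the remainder are shorter, and gains commute.\<close>

lemma (in pair_wf_digraph) closed_walk_gain_eq_1:
  assumes "cycle_balanced G \<phi>" "awalk u p u"
  shows "walk_gain \<phi> p = 1"
  using assms(2)
proof (induction "length p" arbitrary: u p rule: less_induct)
  case less
  show ?case
  proof (cases p)
    case Nil
    then show ?thesis by (simp add: walk_gain_Nil)
  next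
    case (Cons e es)
    with less.prems have e: "e \<in> parcs G" "u = fst e" "awalk (snd e) es u"
      unfolding Cons awalk_Cons_iff by auto
    show ?thesis
    \<comment> \<open>The start vertex reappears as the last vertex of \<open>es\<close>, so the
      vertices of \<open>es\<close> alone decide whether \<open>p\<close> is a cycle.\<close>
    proof (cases "distinct (pawalk_verts (snd e) es)")
      case True
      then have "cycle p" using less.prems Cons by (auto simp: cycle_def)
      then show ?thesis using assms(1) by (simp add: cycle_balanced_def)
    next
      case False
      then obtain q r s w where es: "es = q @ r @ s" "r \<noteq> []"
        "awalk (snd e) q w" "awalk w r w" "awalk w s u"
        using awalk_not_distinct_decomp[OF e(3)] by auto
      have "awalk u (e # q @ s) u"
        using e es awalk_appendI by (auto simp: awalk_Cons_iff simp del: awalk_append_iff)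
      then have "walk_gain \<phi> (e # q @ s) = 1" using less.hyps es Cons by auto
      moreover have "walk_gain \<phi> r = 1" using less.hyps[OF _ es(4)] es Cons by auto
      ultimately show ?thesis
        using Cons es by (simp add: walk_gain_Cons walk_gain_append)
    qed
  qed
qed

text \<open>The product telescopes: at each inner vertex the factors \<psi> and \<open>cnj\<close>
  \<psi> cancel.\<close>

lemma (in pair_wf_digraph) walk_gain_if_potential:
  assumes "potential_function G \<phi> \<psi>" "awalk u p v"
  shows "walk_gain \<phi> p = cnj (\<psi> u) * \<psi> v"
  using assms(2)
proof (induction p arbitrary: u)
  case Nil
  then show ?case
    using assms(1) by (auto simp: awalk_Nil_iff walk_gain_Nil potential_function_def
      unit_circle_iff_cnj mult.commute image_subset_iff)
next
  case (Cons e p)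
  then have e: "e \<in> parcs G" "u = fst e" "awalk (snd e) p v" by (simp_all add: awalk_Cons_iff)
  then have "\<psi> (snd e) * cnj (\<psi> (snd e)) = 1"
    using assms(1) arc_snd_in_verts
    by (auto simp: potential_function_def unit_circle_iff_cnj image_subset_iff)
  moreover have "\<phi> e = cnj (\<psi> u) * \<psi> (snd e)"
    using assms(1) e by (cases e) (auto simp: potential_function_def)
  ultimately show ?case using Cons.IH[OF e(3)] by (simp add: walk_gain_Cons)
qed

lemma (in pair_wf_digraph) cycle_balanced_if_potential:
  assumes "potential_function G \<phi> \<psi>"
  shows "cycle_balanced G \<phi>"
  unfolding cycle_balanced_def
proof (intro allI impI)
  fix p assume "cycle p"
  then obtain u where u: "awalk u p u" by (auto simp: cycle_def)
  then have "u \<in> pverts G" by auto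
  then have "cnj (\<psi> u) * \<psi> u = 1"
    using assms by (auto simp: potential_function_def unit_circle_iff_cnj mult.commute image_subset_iff)
  then show "walk_gain \<phi> p = 1" using walk_gain_if_potential[OF assms u] by simp
qed

lemma (in gain_digraph) walk_gain_in_unit_circle:
  "set p \<subseteq> parcs D \<Longrightarrow> walk_gain \<phi> p \<in> unit_circle"
proof (induction p)
  case (Cons e p)
  then show ?case using gain_unit[of e] by (auto simp: walk_gain_Cons unit_circle_def norm_mult)
qed (simp add: walk_gain_Nil unit_circle_def)

lemma (in gain_digraph) potential_if_cycle_balanced:
  assumes "strongly_connected (with_proj D)" "cycle_balanced D \<phi>"
  shows "\<exists>\<psi>. potential_function D \<phi> \<psi>"
proof -
  obtain r where r: "r \<in> pverts D" using assms(1) by (auto simp: strongly_connected_def)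
  have walk: "\<exists>p. awalk u p v" if "u \<in> pverts D" "v \<in> pverts D" for u v
    using assms(1) that reachable_awalk by (auto simp: strongly_connected_def)
  define P where "P v = (SOME p. awalk r p v)" for v
  have P: "awalk r (P v) v" if "v \<in> pverts D" for v
    unfolding P_def using walk[OF r that] by (rule someI_ex)
  define \<psi> where "\<psi> v = walk_gain \<phi> (P v)" for v
  have unit: "\<psi> v \<in> unit_circle" if "v \<in> pverts D" for v
    unfolding \<psi>_def using P[OF that] by (intro walk_gain_in_unit_circle) auto
  have "\<phi> (u, v) = cnj (\<psi> u) * \<psi> v" if uv: "(u, v) \<in> parcs D" for u v
  proof -
    have verts: "u \<in> pverts D" "v \<in> pverts D" using uv in_arcsD1 in_arcsD2 by auto
    \<comment> \<open>One return walk \<open>q\<close> closes both \<open>P v\<close> and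
      \<open>P u\<close> extended by the arc. Both closed walks have gain 1, and comparing them
      isolates the gain of the arc, whatever walks \<open>P\<close> selects.\<close>
    obtain q where q: "awalk v q r" using walk verts(2) r by blast
    have "awalk r (P v @ q) r" using P[OF verts(2)] q by (rule awalk_appendI)
    from closed_walk_gain_eq_1[OF assms(2) this] have 1: "\<psi> v * walk_gain \<phi> q = 1"
      by (simp add: \<psi>_def walk_gain_append)
    have "awalk u ((u, v) # q) r" using uv q by (simp add: awalk_Cons_iff)
    with P[OF verts(1)] have "awalk r (P u @ (u, v) # q) r" by (rule awalk_appendI)
    from closed_walk_gain_eq_1[OF assms(2) this]
    have 2: "\<psi> u * (\<phi> (u, v) * walk_gain \<phi> q) = 1"
      by (simp add: \<psi>_def walk_gain_append walk_gain_Cons)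
    have 3: "\<psi> u * cnj (\<psi> u) = 1" using unit[OF verts(1)] by (simp add: unit_circle_iff_cnj)
    have "\<phi> (u, v) = (\<psi> u * cnj (\<psi> u)) * \<phi> (u, v) * (\<psi> v * walk_gain \<phi> q)"
      by (simp add: 1 3)
    also have "\<dots> = cnj (\<psi> u) * \<psi> v * (\<psi> u * (\<phi> (u, v) * walk_gain \<phi> q))"
      by (simp add: algebra_simps)
    finally show ?thesis by (simp add: 2)
  qed
  then show ?thesis using unit by (auto simp: potential_function_def)
qed

section \<open>Switching to the all-ones gain\<close>

lemma unit_circle_switch_eq_1_iff:
  assumes "a \<in> unit_circle" "b \<in> unit_circle"
  shows "1 = a * z * cnj b \<longleftrightarrow> z = cnj a * b"
proof -
  have unit: "a * cnj a = 1" "b * cnj b = 1" using assms by (simp_all add: unit_circle_iff_cnj)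
  have "cnj a * (a * z * cnj b) * b = (a * cnj a) * (b * cnj b) * z"
    "a * (cnj a * b) * cnj b = (a * cnj a) * (b * cnj b)"
    by (simp_all add: mult_ac)
  then have z: "cnj a * (a * z * cnj b) * b = z" and 1: "a * (cnj a * b) * cnj b = 1"
    unfolding unit by simp_all
  show ?thesis
  proof
    assume "1 = a * z * cnj b"
    from z[folded this] show "z = cnj a * b" by simp
  qed (simp only: 1)
qed

text \<open>The potentials are exactly the switching functions that turn all gains into 1, with no
  conjugation needed in between: solve for the gain on each arc.\<close>

lemma (in pair_wf_digraph) potential_iff_switch:
  "potential_function G \<phi> \<psi> \<longleftrightarrow>
     \<psi> ` pverts G \<subseteq> unit_circle \<and> (\<forall>e\<in>parcs G. 1 = switch_gain \<psi> \<phi> e)"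
proof -
  have "1 = switch_gain \<psi> \<phi> (u, v) \<longleftrightarrow> \<phi> (u, v) = cnj (\<psi> u) * \<psi> v"
    if "\<psi> ` pverts G \<subseteq> unit_circle" "(u, v) \<in> parcs G" for u v
    using that unit_circle_switch_eq_1_iff[of "\<psi> u" "\<psi> v"] in_arcsD1 in_arcsD2
    by (auto simp: switch_gain_def image_subset_iff)
  then show ?thesis unfolding potential_function_def by fast
qed

lemma (in pair_wf_digraph) switching_equivalent_iff_potential:
  "switching_equivalent G \<phi> (\<lambda>_. 1) \<longleftrightarrow> (\<exists>\<psi>. potential_function G \<phi> \<psi>)"
  by (simp add: switching_equivalent_def potential_iff_switch)

section \<open>Laplacian matrices: similarity and kernel\<close>

lemma gain_laplacian_carrier: "gain_laplacian D \<phi> vs \<in> carrier_mat (length vs) (length vs)"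
  by (simp add: gain_laplacian_def out_deg_mat_def gain_adj_mat_def minus_carrier_mat)

lemma laplacian_eq_gain_laplacian: "laplacian D vs = gain_laplacian D (\<lambda>_. 1) vs"
  by (simp add: laplacian_def gain_laplacian_def adj_mat_def gain_adj_mat_def)

lemma gain_laplacian_index:
  assumes "i < length vs" "j < length vs"
  shows "gain_laplacian D \<phi> vs $$ (i, j) =
    (if i = j then of_nat (out_degree (with_proj D) (vs ! j)) else 0) -
    (if (vs ! i, vs ! j) \<in> parcs D then \<phi> (vs ! i, vs ! j) else 0)"
  using assms by (simp add: gain_laplacian_def out_deg_mat_def gain_adj_mat_def mat_diag_def)

lemma (in pair_wf_digraph) cospectral_if_potential:
  assumes "set vs = pverts G" "potential_function G \<phi> \<psi>"
  shows "cospectral (gain_laplacian G \<phi> vs) (laplacian G vs)"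
proof -
  let ?n = "length vs"
  let ?P = "mat_diag ?n (\<lambda>i. cnj (\<psi> (vs ! i)))" and ?Q = "mat_diag ?n (\<lambda>i. \<psi> (vs ! i))"
  let ?L = "gain_laplacian G (\<lambda>_. 1) vs"
  have unit: "\<psi> (vs ! i) * cnj (\<psi> (vs ! i)) = 1" if "i < ?n" for i
    using assms that by (auto simp: potential_function_def unit_circle_iff_cnj image_subset_iff)
  have PQ: "?P * ?Q = 1\<^sub>m ?n" "?Q * ?P = 1\<^sub>m ?n"
    unfolding mat_diag_diag using unit
    by (auto simp: mat_diag_def mult.commute intro!: eq_matI)
  have "gain_laplacian G \<phi> vs = ?P * ?L * ?Q"
  proof (rule eq_matI)
    fix i j assume "i < dim_row (?P * ?L * ?Q)" "j < dim_col (?P * ?L * ?Q)"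
    then have ij: "i < ?n" "j < ?n" by (simp_all add: mat_diag_def)
    have "(?P * ?L * ?Q) $$ (i, j) = cnj (\<psi> (vs ! i)) * ?L $$ (i, j) * \<psi> (vs ! j)"
      using ij by (simp add: mat_diag_mult_left[OF gain_laplacian_carrier]
          mat_diag_mult_right[of _ ?n])
    \<comment> \<open>The degree term on the diagonal survives because it is multiplied by
      \<open>cnj\<close> \<psi> times \<psi>, which is 1; each arc entry picks up exactly its
      gain.\<close>
    also have "\<dots> = gain_laplacian G \<phi> vs $$ (i, j)"
      using ij unit[OF ij(1)] assms(2)
      by (auto simp: gain_laplacian_index potential_function_def algebra_simps)
    finally show "gain_laplacian G \<phi> vs $$ (i, j) = (?P * ?L * ?Q) $$ (i, j)" by simp
  qed (use gain_laplacian_carrier[of G \<phi> vs] in \<open>auto simp: mat_diag_def\<close>)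
  moreover have "{gain_laplacian G \<phi> vs, ?L, ?P, ?Q} \<subseteq> carrier_mat ?n ?n"
    using gain_laplacian_carrier by auto
  ultimately have "similar_mat (gain_laplacian G \<phi> vs) ?L"
    using PQ by (intro similar_matI[where P = ?P and Q = ?Q and n = ?n])
  then show ?thesis
    by (simp add: cospectral_def laplacian_eq_gain_laplacian char_poly_similar)
qed

text \<open>The out-degree counts the out-neighbours, so the diagonal term can be distributed over
  them. This is the form to which \<open>eq_center_if_sum_diff_eq_0\<close> applies.\<close>

lemma (in pair_fin_digraph) gain_laplacian_mult_vec:
  assumes "distinct vs" "set vs = pverts G" "i < length vs"
  shows "(gain_laplacian G \<phi> vs *\<^sub>v vec (length vs) (\<lambda>j. x (vs ! j))) $ i =
    (\<Sum>w\<in>parcs G `` {vs ! i}. x (vs ! i) - \<phi> (vs ! i, w) * x w)"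
proof -
  let ?n = "length vs" and ?v = "vs ! i"
  let ?d = "of_nat (out_degree (with_proj G) ?v) :: complex"
  let ?a = "\<lambda>w. if (?v, w) \<in> parcs G then \<phi> (?v, w) * x w else 0"
  have nbrs: "parcs G `` {?v} \<subseteq> pverts G" using in_arcsD2 by auto
  have "out_arcs (with_proj G) ?v = Pair ?v ` (parcs G `` {?v})" by (auto simp: out_arcs_def)
  then have deg: "out_degree (with_proj G) ?v = card (parcs G `` {?v})"
    by (simp add: out_degree_def card_image inj_on_def)
  have "(gain_laplacian G \<phi> vs *\<^sub>v vec ?n (\<lambda>j. x (vs ! j))) $ i =
      (\<Sum>j<?n. gain_laplacian G \<phi> vs $$ (i, j) * x (vs ! j))"
    using assms(3) gain_laplacian_carrier[of G \<phi> vs]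
    by (simp add: scalar_prod_def atLeast0LessThan)
  also have "\<dots> = (\<Sum>j<?n. (if i = j then ?d * x ?v else 0) - ?a (vs ! j))"
    using assms(3) by (intro sum.cong) (auto simp: gain_laplacian_index algebra_simps)
  also have "\<dots> = ?d * x ?v - (\<Sum>j<?n. ?a (vs ! j))"
    using assms(3) by (simp add: sum_subtractf)
  also have "(\<Sum>j<?n. ?a (vs ! j)) = (\<Sum>w\<in>pverts G. ?a w)"
    by (rule sum.reindex_bij_betw) (use assms in \<open>auto intro: bij_betw_nth\<close>)
  also have "\<dots> = (\<Sum>w\<in>parcs G `` {?v}. \<phi> (?v, w) * x w)"
    using nbrs pair_finite_verts by (intro sum.mono_neutral_cong_right) auto
  finally show ?thesis by (simp add: deg sum_subtractf)
qed

text \<open>Replaces vectors indexed by positions in \<open>vs\<close> with functions on vertices,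
  so that the maximum argument needs no matrices.\<close>

lemma (in pair_fin_digraph) eigenvalue_0_gain_laplacian_iff:
  assumes "distinct vs" "set vs = pverts G"
  shows "eigenvalue (gain_laplacian G \<phi> vs) 0 \<longleftrightarrow>
    (\<exists>x. (\<exists>v\<in>pverts G. x v \<noteq> 0) \<and>
      (\<forall>v\<in>pverts G. (\<Sum>w\<in>parcs G `` {v}. x v - \<phi> (v, w) * x w) = 0))"
proof -
  let ?n = "length vs" and ?L = "gain_laplacian G \<phi> vs"
  have kernel: "eigenvector ?L (vec ?n (\<lambda>j. x (vs ! j))) 0 \<longleftrightarrow>
      (\<exists>v\<in>pverts G. x v \<noteq> 0) \<and>
      (\<forall>v\<in>pverts G. (\<Sum>w\<in>parcs G `` {v}. x v - \<phi> (v, w) * x w) = 0)" for x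
  proof -
    have "vec ?n (\<lambda>j. x (vs ! j)) = 0\<^sub>v ?n \<longleftrightarrow> (\<forall>v\<in>pverts G. x v = 0)"
      by (simp add: vec_eq_iff all_set_conv_all_nth flip: assms(2))
    then have "vec ?n (\<lambda>j. x (vs ! j)) \<noteq> 0\<^sub>v ?n \<longleftrightarrow> (\<exists>v\<in>pverts G. x v \<noteq> 0)"
      by blast
    moreover have "?L *\<^sub>v vec ?n (\<lambda>j. x (vs ! j)) = 0 \<cdot>\<^sub>v vec ?n (\<lambda>j. x (vs ! j)) \<longleftrightarrow>
        (\<forall>i<?n. (\<Sum>w\<in>parcs G `` {vs ! i}. x (vs ! i) - \<phi> (vs ! i, w) * x w) = 0)"
      using gain_laplacian_carrier[of G \<phi> vs]
      by (auto simp: vec_eq_iff gain_laplacian_mult_vec[OF assms] simp del: index_mult_mat_vec)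
    moreover have "\<dots> \<longleftrightarrow>
        (\<forall>v\<in>pverts G. (\<Sum>w\<in>parcs G `` {v}. x v - \<phi> (v, w) * x w) = 0)"
      by (simp add: all_set_conv_all_nth flip: assms(2))
    ultimately show ?thesis
      using gain_laplacian_carrier[of G \<phi> vs] by (simp add: eigenvector_def)
  qed
  \<comment> \<open>Distinctness of \<open>vs\<close> lets each vertex recover its position, so
    every vector arises from a vertex function.\<close>
  have vec_of_fun: "\<exists>x. y = vec ?n (\<lambda>j. x (vs ! j))" if "y \<in> carrier_vec ?n" for y :: "complex vec"
  proof
    have "inj_on ((!) vs) {..<?n}" using assms(1) by (auto simp: inj_on_nth)
    then show "y = vec ?n (\<lambda>j. (y $ the_inv_into {..<?n} ((!) vs) (vs ! j)))"
      using that by (auto simp: the_inv_into_f_f)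
  qed
  have "eigenvalue ?L 0 \<longleftrightarrow> (\<exists>x. eigenvector ?L (vec ?n (\<lambda>j. x (vs ! j))) 0)"
  proof
    assume "eigenvalue ?L 0"
    then obtain y where y: "eigenvector ?L y 0" by (auto simp: eigenvalue_def)
    then have "y \<in> carrier_vec ?n"
      using gain_laplacian_carrier[of G \<phi> vs] by (simp add: eigenvector_def)
    from vec_of_fun[OF this] y show "\<exists>x. eigenvector ?L (vec ?n (\<lambda>j. x (vs ! j))) 0" by blast
  qed (auto simp: eigenvalue_def)
  then show ?thesis by (simp only: kernel)
qed

text \<open>For the constant function 1 every summand is 1 - 1.\<close>

lemma (in pair_fin_digraph) eigenvalue_0_laplacian:
  assumes "distinct vs" "set vs = pverts G" "pverts G \<noteq> {}"
  shows "eigenvalue (laplacian G vs) 0"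
  unfolding laplacian_eq_gain_laplacian eigenvalue_0_gain_laplacian_iff[OF assms(1,2)]
  using assms(3) by (intro exI[of _ "\<lambda>_. 1"]) auto

section \<open>Maximum principle for kernel functions\<close>

lemma (in gain_digraph) potential_if_kernel:
  assumes "strongly_connected (with_proj D)" "v\<^sub>0 \<in> pverts D" "x v\<^sub>0 \<noteq> 0"
    and ker: "\<And>v. v \<in> pverts D \<Longrightarrow> (\<Sum>w\<in>parcs D `` {v}. x v - \<phi> (v, w) * x w) = 0"
  shows "\<exists>\<psi>. potential_function D \<phi> \<psi>"
proof -
  define M where "M = Max ((\<lambda>v. cmod (x v)) ` pverts D)"
  have le_M: "cmod (x v) \<le> M" if "v \<in> pverts D" for v
    unfolding M_def using that pair_finite_verts by simp
  have "M \<in> (\<lambda>v. cmod (x v)) ` pverts D"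
    unfolding M_def using assms(2) pair_finite_verts by (intro Max_in) auto
  then obtain m where m: "m \<in> pverts D" "cmod (x m) = M" by auto
  have "0 < M" using assms(3) le_M[OF assms(2)] by (meson less_le_trans zero_less_norm_iff)
  have norm_gain: "cmod (\<phi> e) = 1" if "e \<in> parcs D" for e
    using gain_unit[OF that] by (simp add: unit_circle_def)
  \<comment> \<open>Maximality at \<open>u\<close> bounds every term by the modulus of
    \<open>x u\<close>, so the equality case forces each term to equal \<open>x u\<close>.\<close>
  have edge: "\<phi> (u, w) * x w = x u" if "(u, w) \<in> parcs D" "cmod (x u) = M" for u w
  proof (rule eq_center_if_sum_diff_eq_0[where b = "\<lambda>s. \<phi> (u, s) * x s"])
    show "finite (parcs D `` {u})"
      using in_arcsD2 by (intro finite_subset[OF _ pair_finite_verts]) auto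
    show "(\<Sum>w\<in>parcs D `` {u}. x u - \<phi> (u, w) * x w) = 0" using that in_arcsD1 by (intro ker) auto
    show "cmod (\<phi> (u, s) * x s) \<le> cmod (x u)" if "s \<in> parcs D `` {u}" for s
      using that \<open>cmod (x u) = M\<close> le_M in_arcsD2 by (auto simp: norm_mult norm_gain)
    show "w \<in> parcs D `` {u}" using that by simp
  qed
  have norm_x: "cmod (x v) = M" if "v \<in> pverts D" for v
  proof -
    have "m \<rightarrow>\<^sup>*\<^bsub>with_proj D\<^esub> v" using assms(1) m that by (auto simp: strongly_connected_def)
    then show ?thesis
    proof (induction rule: reachable_induct)
      case (step u w)
      then have uw: "(u, w) \<in> parcs D" by simp
      have "cmod (\<phi> (u, w) * x w) = M" using edge[OF uw step.IH] step.IH by simp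
      then show ?case by (simp add: norm_mult norm_gain[OF uw])
    qed (rule m(2))
  qed
  \<comment> \<open>The conjugate is forced by the convention for potentials: \<open>edge\<close>
    makes the gain equal to \<open>x u * cnj (x w)\<close> divided by the square of
    \<open>M\<close>, whereas a potential carries its conjugate at the tail
    \<open>u\<close>.\<close>
  define \<psi> where "\<psi> v = cnj (x v) / of_real M" for v
  have unit: "\<psi> v \<in> unit_circle" if "v \<in> pverts D" for v
    using norm_x[OF that] \<open>0 < M\<close> by (simp add: \<psi>_def unit_circle_def norm_divide)
  have "\<phi> (u, w) = cnj (\<psi> u) * \<psi> w" if uw: "(u, w) \<in> parcs D" for u w
  proof -
    have verts: "u \<in> pverts D" "w \<in> pverts D" using uw in_arcsD1 in_arcsD2 by auto
    have "cnj (\<psi> u) = \<phi> (u, w) * cnj (\<psi> w)"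
      using edge[OF uw norm_x[OF verts(1)]] by (simp add: \<psi>_def)
    moreover have "\<psi> w * cnj (\<psi> w) = 1" using unit[OF verts(2)] by (simp add: unit_circle_iff_cnj)
    ultimately show ?thesis by (simp add: mult.assoc mult.commute)
  qed
  then show ?thesis using unit by (auto simp: potential_function_def)
qed

theorem theorem5p3:
  fixes D :: "'a pair_pre_digraph"
    and \<phi> :: "'a \<times> 'a \<Rightarrow> complex"
    and vs :: "'a list"
  assumes "gain_digraph D \<phi>"
    and "strongly_connected (with_proj D)"
    and "distinct vs" and "set vs = pverts D"
  shows "(cycle_balanced D \<phi> \<longleftrightarrow> switching_equivalent D \<phi> (\<lambda>_. 1))
    \<and> (switching_equivalent D \<phi> (\<lambda>_. 1) \<longleftrightarrow> (\<exists>\<psi>. potential_function D \<phi> \<psi>))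
    \<and> (switching_equivalent D \<phi> (\<lambda>_. 1)
         \<longleftrightarrow> cospectral (gain_laplacian D \<phi> vs) (laplacian D vs))
    \<and> (cospectral (gain_laplacian D \<phi> vs) (laplacian D vs)
         \<longleftrightarrow> eigenvalue (gain_laplacian D \<phi> vs) 0)"
proof -
  interpret gain_digraph D \<phi> by (rule assms(1))
  let ?L = "gain_laplacian D \<phi> vs"
  let ?pot = "\<exists>\<psi>. potential_function D \<phi> \<psi>"
  have cyc: "cycle_balanced D \<phi> \<longleftrightarrow> ?pot"
    using cycle_balanced_if_potential potential_if_cycle_balanced[OF assms(2)] by blast
  have cosp: "cospectral ?L (laplacian D vs)" if ?pot
    using that cospectral_if_potential[OF assms(4)] by blast
  \<comment> \<open>Strong connectedness includes a nonempty vertex set. Equal characteristic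
    polynomials then carry the root 0 over to \<open>?L\<close>.\<close>
  have "eigenvalue (laplacian D vs) 0"
    using eigenvalue_0_laplacian[OF assms(3,4)] assms(2) by (simp add: strongly_connected_def)
  then have ev: "eigenvalue ?L 0" if "cospectral ?L (laplacian D vs)"
    using that by (simp add: cospectral_def laplacian_eq_gain_laplacian
        eigenvalue_root_char_poly[OF gain_laplacian_carrier])
  have "?pot" if "eigenvalue ?L 0"
    using that potential_if_kernel[OF assms(2)]
    by (auto simp: eigenvalue_0_gain_laplacian_iff[OF assms(3,4)])
  with cyc cosp ev show ?thesis
    unfolding switching_equivalent_iff_potential by blast
qed

end
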